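(* Let $A$ be a finite set, $(M,d)$ a nonempty complete metric space, $\sigma : A\to\operatorname{Con}(M,d)$ a contraction operator interpretation, and $(X,\alpha)$ a finite productive labelled transition system with labels in $A$. Then: (1) for every $x\in X$, the set $[\![x]\!]_{\alpha,\sigma}$ is nonempty and compact; (2) the map $x\mapsto [\![x]\!]_{\alpha,\sigma}$, $X\to\mathbf K(M,d)$, is the unique $\sigma$-solution to $(X,\alpha)$.
   Context: An LTS is $(X,\alpha)$ with $\alpha:X\to\mathcal P(A\times X)$; write $x\xrightarrow{a}y$ if $(a,y)\in\alpha(x)$. It is productive if $\alpha(x)\ne\emptyset$ for all $x$. A stream is an infinite sequence $(a_1,a_2,\dots)$ of elements of $A$; a state $x$ emits it if for every $n>0$ there is a path $x\xrightarrow{a_1}x_1\xrightarrow{a_2}\cdots\xrightarrow{a_n}x_n$. $\operatorname{Con}(M,d)$ is the set of maps $h:M\to M$ with $d(h(p),h(q))\le r\,d(p,q)$ for some $r\in[0,1)$; $\sigma_a=\sigma(a)$. For a stream, $\sigma_\omega(a_1,a_2,\dots)=\lim_{n\to\infty}\sigma_{a_1}\sigma_{a_2}\cdots\sigma_{a_n}(p)$ for an arbitrary $p\in M$ (the limit exists and is independent of $p$). Define $[\![x]\!]_{\alpha,\sigma}=\{\sigma_\omega(a_1,\dots) : (a_1,\dots)\text{ emitted by }x\}$. $\mathbf K(M,d)$ is the set of nonempty compact subsets of $M$. A map $\varphi:X\to\mathbf K(M,d)$ is a $\sigma$-solution to $(X,\alpha)$ if $\varphi(x)=\bigcup_{x\xrightarrow{a}y}\sigma_a(\varphi(y))$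 for all $x\in X$. *)

theory Defs
  imports "HOL-Analysis.Analysis"
begin

definition lts :: "'a set \<Rightarrow> 'x set \<Rightarrow> ('x \<Rightarrow> ('a \<times> 'x) set) \<Rightarrow> bool" where
  "lts A X \<alpha> \<longleftrightarrow> \<alpha> \<in> X \<rightarrow> Pow (A \<times> X)"

definition productive :: "'x set \<Rightarrow> ('x \<Rightarrow> ('a \<times> 'x) set) \<Rightarrow> bool" where
  "productive X \<alpha> \<longleftrightarrow> (\<forall>x\<in>X. \<alpha> x \<noteq> {})"

(* Streams are indexed from 0, so s i is the letter usually written a_(i+1).
   The path q may depend on n.  For a state of an LTS with labels in A, every
   emitted stream automatically has all its letters in A. *)
definition emits :: "('x \<Rightarrow> ('a \<times> 'x) set) \<Rightarrow> 'x \<Rightarrow> (nat \<Rightarrow> 'a) \<Rightarrow> bool" where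
  "emits \<alpha> x s \<longleftrightarrow>
     (\<forall>n>0. \<exists>q :: nat \<Rightarrow> 'x. q 0 = x \<and> (\<forall>i<n. (s i, q (Suc i)) \<in> \<alpha> (q i)))"

definition contractions :: "('m::metric_space \<Rightarrow> 'm) set" where
  "contractions = {h. \<exists>r\<in>{0..<1}. \<forall>p q. dist (h p) (h q) \<le> r * dist p q}"

primrec prefix_map :: "('a \<Rightarrow> 'm \<Rightarrow> 'm) \<Rightarrow> (nat \<Rightarrow> 'a) \<Rightarrow> nat \<Rightarrow> 'm \<Rightarrow> 'm" where
  "prefix_map \<sigma> s 0 = id"
| "prefix_map \<sigma> s (Suc n) = prefix_map \<sigma> s n \<circ> \<sigma> (s n)"

(* The common limit for all base points p. *)
definition sigma_omega :: "('a \<Rightarrow> 'm \<Rightarrow> 'm::metric_space) \<Rightarrow> (nat \<Rightarrow> 'a) \<Rightarrow> 'm" where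
  "sigma_omega \<sigma> s = (THE l. \<forall>p. (\<lambda>n. prefix_map \<sigma> s n p) \<longlonglongrightarrow> l)"

definition denotation ::
  "('x \<Rightarrow> ('a \<times> 'x) set) \<Rightarrow> ('a \<Rightarrow> 'm \<Rightarrow> 'm::metric_space) \<Rightarrow> 'x \<Rightarrow> 'm set" where
  "denotation \<alpha> \<sigma> x = {sigma_omega \<sigma> s | s. emits \<alpha> x s}"

definition nonempty_compacts :: "'m::metric_space set set" where
  "nonempty_compacts = {S. S \<noteq> {} \<and> compact S}"

definition sigma_solution ::
  "'x set \<Rightarrow> ('x \<Rightarrow> ('a \<times> 'x) set) \<Rightarrow> ('a \<Rightarrow> 'm \<Rightarrow> 'm::metric_space) \<Rightarrow> ('x \<Rightarrow> 'm set) \<Rightarrow> bool"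
where
  "sigma_solution X \<alpha> \<sigma> \<phi> \<longleftrightarrow>
     \<phi> \<in> X \<rightarrow> nonempty_compacts \<and>
     (\<forall>x\<in>X. \<phi> x = (\<Union>(a, y)\<in>\<alpha> x. \<sigma> a ` \<phi> y))"

end

(* The equation for the denotation follows from a one-step Koenig argument, and any solution
   \<phi> agrees with it: points of \<phi> x unfold into infinite paths, and conversely
   prefix images of points of \<phi> lie in \<phi> x and converge to the stream limit.
   Compactness then comes for free.  Iterating the equation on an invariant ball shows that the
   denotations are totally bounded, so their closures are compact and again form a solution;
   by the uniqueness argument the closures equal the denotations. *)
theory Submission
  imports Defs
begin

section \<open>Prefix maps and emitted streams\<close>

lemma prefix_map_add:
  "prefix_map \<sigma> s (n + k) p = prefix_map \<sigma> s n (prefix_map \<sigma> (\<lambda>i. s (n + i)) k p)"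
  by (induction k arbitrary: p) auto

text \<open>The recursion of \<open>prefix_map\<close> adds the last letter on the inside. Peeling
  off the outermost, first letter instead is what matches one step of the transition system.\<close>

lemma prefix_map_Suc_shift:
  "prefix_map \<sigma> s (Suc n) p = \<sigma> (s 0) (prefix_map \<sigma> (\<lambda>i. s (Suc i)) n p)"
  using prefix_map_add[of \<sigma> s 1 n p] by simp

lemma emits_infinite_path:
  assumes "q 0 = x" "\<And>i. (s i, q (Suc i)) \<in> \<alpha> (q i)"
  shows "emits \<alpha> x s"
  using assms unfolding emits_def by blast

lemma emits_Cons:
  assumes "(a, y) \<in> \<alpha> x" "emits \<alpha> y s"
  shows "emits \<alpha> x (case_nat a s)"
  unfolding emits_def
proof (intro allI impI)
  fix n :: nat
  \<comment> \<open>Length \<open>Suc n\<close> is requested because emission provides paths of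
    positive length only, while \<open>n - 1\<close> steps, possibly none, remain after the new
    edge.\<close>
  obtain q where q: "q 0 = y" "\<forall>i<Suc n. (s i, q (Suc i)) \<in> \<alpha> (q i)"
    using assms(2) unfolding emits_def by blast
  show "\<exists>q. q 0 = x \<and> (\<forall>i<n. (case_nat a s i, q (Suc i)) \<in> \<alpha> (q i))"
    by (rule exI[of _ "case_nat x q"]) (use assms(1) q in \<open>auto split: nat.split\<close>)
qed

text \<open>Koenig step: the paths witnessing emission may leave \<open>x\<close> through different
  successors for different lengths. Finite branching yields one successor that serves all
  lengths.\<close>

lemma emits_uncons:
  assumes "emits \<alpha> x s" "finite (\<alpha> x)"
  obtains y where "(s 0, y) \<in> \<alpha> x" "emits \<alpha> y (\<lambda>i. s (Suc i))"
proof -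
  let ?path = "\<lambda>y n. \<exists>q. q 0 = y \<and> (\<forall>i<n. (s (Suc i), q (Suc i)) \<in> \<alpha> (q i))"
  have "\<exists>y. (s 0, y) \<in> \<alpha> x \<and> emits \<alpha> y (\<lambda>i. s (Suc i))"
  proof (rule ccontr)
    assume neg: "\<not> ?thesis"
    define Y where "Y = {y. (s 0, y) \<in> \<alpha> x}"
    have "Y \<subseteq> snd ` \<alpha> x" by (force simp: Y_def)
    then have finY: "finite Y" using assms(2) finite_surj by blast
    have "\<forall>y\<in>Y. \<exists>n. \<not> ?path y n"
      using neg unfolding Y_def emits_def by blast
    then obtain N where N: "\<And>y. y \<in> Y \<Longrightarrow> \<not> ?path y (N y)" by metis
    \<comment> \<open>If each candidate successor fails at some length, \<open>m\<close> dominates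
      all these lengths. A path of length \<open>Suc m\<close> from \<open>x\<close> then still has
      \<open>m\<close> steps after its first edge, too many for the successor it passes through. The
      inserted 0 keeps \<open>Max\<close> meaningful for empty \<open>Y\<close>.\<close>
    define m where "m = Max (insert 0 (N ` Y))"
    have m: "N y \<le> m" if "y \<in> Y" for y
      using that finY unfolding m_def by simp
    obtain q where q: "q 0 = x" "\<forall>i<Suc m. (s i, q (Suc i)) \<in> \<alpha> (q i)"
      using assms(1) unfolding emits_def by blast
    have "q 1 \<in> Y" using q by (force simp: Y_def)
    moreover from this have "?path (q 1) (N (q 1))"
      using q(2) m[of "q 1"] by (intro exI[of _ "\<lambda>i. q (Suc i)"]) auto
    ultimately show False using N by blast
  qed
  then show ?thesis using that by blast
qed

lemma closure_UN_finite:
  "finite I \<Longrightarrow> closure (\<Union>i\<in>I. S i) = (\<Union>i\<in>I. closure (S i))"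
  by (induction I rule: finite_induct) auto

section \<open>Contraction estimates and stream limits\<close>

locale contractive_lts =
  fixes A :: "'a set"
    and X :: "'x set"
    and \<alpha> :: "'x \<Rightarrow> ('a \<times> 'x) set"
    and \<sigma> :: "'a \<Rightarrow> 'm \<Rightarrow> 'm::complete_space"
    and r :: real
  assumes finite_A: "finite A"
    and finite_X: "finite X"
    and edge: "\<And>x a y. x \<in> X \<Longrightarrow> (a, y) \<in> \<alpha> x \<Longrightarrow> a \<in> A \<and> y \<in> X"
    and productive: "\<And>x. x \<in> X \<Longrightarrow> \<alpha> x \<noteq> {}"
    and r_nonneg: "0 \<le> r"
    and r_less: "r < 1"
    and contraction: "\<And>a p q. a \<in> A \<Longrightarrow> dist (\<sigma> a p) (\<sigma> a q) \<le> r * dist p q"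
begin

lemma finite_edges: "x \<in> X \<Longrightarrow> finite (\<alpha> x)"
  by (rule finite_subset[of _ "A \<times> X"]) (use edge finite_A finite_X in auto)

lemma path_in_X:
  assumes "q 0 \<in> X" "\<forall>i<n. (s i, q (Suc i)) \<in> \<alpha> (q i)"
  shows "i \<le> n \<Longrightarrow> q i \<in> X"
  using assms edge by (induction i) (auto dest: Suc_leD Suc_le_lessD)

text \<open>Contraction is assumed only for letters in \<open>A\<close>; this makes the convergence
  results applicable to emitted streams.\<close>

lemma emits_letters:
  assumes "x \<in> X" "emits \<alpha> x s"
  shows "range s \<subseteq> A"
proof clarify
  fix i
  obtain q where q: "q 0 = x" "\<forall>j<Suc i. (s j, q (Suc j)) \<in> \<alpha> (q j)"
    using assms(2) unfolding emits_def by blast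
  then have "q i \<in> X" using path_in_X[of q "Suc i" s i] assms(1) by simp
  then show "s i \<in> A" using edge q(2) by blast
qed

lemma prefix_map_contraction:
  assumes "range s \<subseteq> A"
  shows "dist (prefix_map \<sigma> s n p) (prefix_map \<sigma> s n q) \<le> r ^ n * dist p q"
proof (induction n arbitrary: p q)
  case (Suc n)
  have "dist (prefix_map \<sigma> s (Suc n) p) (prefix_map \<sigma> s (Suc n) q)
      \<le> r ^ n * dist (\<sigma> (s n) p) (\<sigma> (s n) q)"
    using Suc.IH by simp
  also have "\<dots> \<le> r ^ n * (r * dist p q)"
    using assms by (intro mult_left_mono contraction) (auto simp: r_nonneg)
  finally show ?case by (simp add: mult_ac)
qed simp

lemma power_r_tendsto: "(\<lambda>n. r ^ n * C) \<longlonglongrightarrow> 0"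
  using LIMSEQ_power_zero[of r] r_nonneg r_less tendsto_mult_left_zero by force

text \<open>A letter moves \<open>p0\<close> by at most \<open>D\<close> and shrinks distances by
  \<open>r\<close>, so it maps the ball of radius \<open>C\<close> about \<open>p0\<close> into the
  ball of radius \<open>D + r * C\<close>. The choice of \<open>C\<close> solves
  \<open>D + r * C = C\<close>.\<close>

lemma invariant_ball:
  obtains C where "0 \<le> C" "\<And>a p. a \<in> A \<Longrightarrow> p \<in> cball p0 C \<Longrightarrow> \<sigma> a p \<in> cball p0 C"
proof -
  define D where "D = (\<Sum>a\<in>A. dist p0 (\<sigma> a p0))"
  define C where "C = D / (1 - r)"
  have D: "dist p0 (\<sigma> a p0) \<le> D" if "a \<in> A" for a
    unfolding D_def using that finite_A by (intro member_le_sum) auto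
  have "0 \<le> D" by (simp add: D_def sum_nonneg)
  then have C0: "0 \<le> C" using r_less by (simp add: C_def)
  have C: "D + r * C = C" using r_less by (simp add: C_def field_simps)
  have "\<sigma> a p \<in> cball p0 C" if "a \<in> A" "p \<in> cball p0 C" for a p
  proof -
    have "dist p0 (\<sigma> a p) \<le> dist p0 (\<sigma> a p0) + dist (\<sigma> a p0) (\<sigma> a p)"
      by (rule dist_triangle)
    also have "\<dots> \<le> D + r * dist p0 p"
      using D contraction that(1) by (intro add_mono)
    also have "\<dots> \<le> D + r * C"
      using that(2) r_nonneg by (intro add_mono mult_left_mono) auto
    finally show ?thesis using C by simp
  qed
  with C0 show ?thesis using that by blast
qed

lemma prefix_map_in_ball:
  assumes "range s \<subseteq> A" "\<And>a p. a \<in> A \<Longrightarrow> p \<in> B \<Longrightarrow> \<sigma> a p \<in> B" "p \<in> B"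
  shows "prefix_map \<sigma> s n p \<in> B"
  using assms(3)
proof (induction n arbitrary: p)
  case (Suc n)
  then show ?case using assms(1) assms(2)[of "s n"] by auto
qed simp

text \<open>The base point may change with \<open>n\<close> as long as it stays at bounded distance
  from \<open>p\<close>, since the factor \<open>r ^ n\<close> absorbs the difference. This gives
  independence of the base point and drives both inclusions of the uniqueness proof.\<close>

lemma prefix_map_same_limit:
  assumes s: "range s \<subseteq> A" and lim: "(\<lambda>n. prefix_map \<sigma> s n p) \<longlonglongrightarrow> l"
    and bdd: "\<And>n. dist (f n) p \<le> C"
  shows "(\<lambda>n. prefix_map \<sigma> s n (f n)) \<longlonglongrightarrow> l"
proof -
  have "dist (prefix_map \<sigma> s n (f n)) (prefix_map \<sigma> s n p) \<le> r ^ n * C" for n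
    by (rule order_trans[OF prefix_map_contraction[OF s]])
       (use bdd r_nonneg in \<open>simp add: mult_left_mono\<close>)
  then have le: "dist (prefix_map \<sigma> s n (f n)) l \<le> r ^ n * C + dist (prefix_map \<sigma> s n p) l" for n
    by (meson add_right_mono dist_triangle order_trans)
  have "(\<lambda>n. r ^ n * C + dist (prefix_map \<sigma> s n p) l) \<longlonglongrightarrow> 0"
    using tendsto_add[OF power_r_tendsto[of C] lim[THEN tendsto_dist_iff[THEN iffD1]]] by simp
  then have "(\<lambda>n. dist (prefix_map \<sigma> s n (f n)) l) \<longlonglongrightarrow> 0"
    by (rule tendsto_sandwich[OF _ _ tendsto_const, rotated 2]) (auto simp: le)
  then show ?thesis by (rule tendsto_dist_iff[THEN iffD2])
qed

lemma sigma_omega_limit: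
  assumes s: "range s \<subseteq> A"
  shows "(\<lambda>n. prefix_map \<sigma> s n p) \<longlonglongrightarrow> sigma_omega \<sigma> s"
proof -
  obtain C where C: "0 \<le> C" "\<And>a q. a \<in> A \<Longrightarrow> q \<in> cball p C \<Longrightarrow> \<sigma> a q \<in> cball p C"
    using invariant_ball[of p] by blast
  \<comment> \<open>The two prefixes share their first \<open>n\<close> letters. The remaining
    letters keep \<open>p\<close> in the invariant ball centred at \<open>p\<close>, hence within
    \<open>C\<close> of it, and the common prefix shrinks that distance by
    \<open>r ^ n\<close>.\<close>
  have dist_le: "dist (prefix_map \<sigma> s n p) (prefix_map \<sigma> s m p) \<le> r ^ n * C" if "n \<le> m" for n m
  proof -
    obtain k where k: "m = n + k" using le_Suc_ex[OF \<open>n \<le> m\<close>] by blast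
    have "prefix_map \<sigma> (\<lambda>i. s (n + i)) k p \<in> cball p C"
      using s C by (intro prefix_map_in_ball) auto
    then show ?thesis
      unfolding k prefix_map_add
      by (intro order_trans[OF prefix_map_contraction[OF s]] mult_left_mono)
         (auto simp: r_nonneg)
  qed
  have "Cauchy (\<lambda>n. prefix_map \<sigma> s n p)"
    unfolding Cauchy_altdef
  proof (intro allI impI)
    fix e :: real
    assume "e > 0"
    then have "\<forall>\<^sub>F n in sequentially. r ^ n * C < e"
      by (rule order_tendstoD(2)[OF power_r_tendsto])
    then obtain N where "\<And>n. n \<ge> N \<Longrightarrow> r ^ n * C < e"
      unfolding eventually_sequentially by blast
    then show "\<exists>M. \<forall>m\<ge>M. \<forall>n>m. dist (prefix_map \<sigma> s m p) (prefix_map \<sigma> s n p) < e"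
      using dist_le by (meson le_less_trans less_imp_le)
  qed
  then obtain l where l: "(\<lambda>n. prefix_map \<sigma> s n p) \<longlonglongrightarrow> l"
    using Cauchy_convergent_iff convergent_def by blast
  \<comment> \<open>Constant base points \<open>f n = q\<close>, with bound \<open>dist q p\<close>:
    all starting points share the limit \<open>l\<close>, so the definite description denotes
    it.\<close>
  then have lq: "\<forall>q. (\<lambda>n. prefix_map \<sigma> s n q) \<longlonglongrightarrow> l"
    using prefix_map_same_limit[OF s l order_refl] by blast
  then have "sigma_omega \<sigma> s = l"
    unfolding sigma_omega_def by (intro the_equality) (blast intro: LIMSEQ_unique)+
  then show ?thesis using l by simp
qed

lemma sigma_omega_eqI:
  assumes "range s \<subseteq> A" "(\<lambda>n. prefix_map \<sigma> s n p) \<longlonglongrightarrow> l"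
  shows "sigma_omega \<sigma> s = l"
  using LIMSEQ_unique[OF sigma_omega_limit[OF assms(1)] assms(2)] .

lemma continuous_contraction: "a \<in> A \<Longrightarrow> continuous_on S (\<sigma> a)"
  by (rule lipschitz_on_continuous_on[of r])
     (auto simp: lipschitz_on_def r_nonneg contraction)

text \<open>Continuity of the first letter's map lets it be pulled out of the limit.\<close>

lemma sigma_omega_Suc:
  assumes s: "range s \<subseteq> A"
  shows "sigma_omega \<sigma> s = \<sigma> (s 0) (sigma_omega \<sigma> (\<lambda>i. s (Suc i)))"
proof (rule sigma_omega_eqI[OF s])
  fix p
  have "(\<lambda>n. \<sigma> (s 0) (prefix_map \<sigma> (\<lambda>i. s (Suc i)) n p))
      \<longlonglongrightarrow> \<sigma> (s 0) (sigma_omega \<sigma> (\<lambda>i. s (Suc i)))"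
    by (rule continuous_on_tendsto_compose[OF continuous_contraction[of "s 0" UNIV]
          sigma_omega_limit]) (use s in auto)
  then show "(\<lambda>n. prefix_map \<sigma> s n p) \<longlonglongrightarrow> \<sigma> (s 0) (sigma_omega \<sigma> (\<lambda>i. s (Suc i)))"
    unfolding prefix_map_Suc_shift[symmetric] by (rule LIMSEQ_imp_Suc)
qed

section \<open>The solution equation and nonemptiness of denotations\<close>

text \<open>Splitting an emitted stream into first letter and tail uses the Koenig step; the
  converse prepends the letter of an edge. On limits, both directions amount to
  \<open>sigma_omega_Suc\<close>.\<close>

lemma denotation_eq:
  assumes x: "x \<in> X"
  shows "denotation \<alpha> \<sigma> x = (\<Union>(a, y)\<in>\<alpha> x. \<sigma> a ` denotation \<alpha> \<sigma> y)"
proof (intro equalityI subsetI)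
  fix z
  assume "z \<in> denotation \<alpha> \<sigma> x"
  then obtain s where s: "emits \<alpha> x s" "z = sigma_omega \<sigma> s" by (auto simp: denotation_def)
  obtain y where y: "(s 0, y) \<in> \<alpha> x" "emits \<alpha> y (\<lambda>i. s (Suc i))"
    using emits_uncons[OF s(1) finite_edges[OF x]] .
  have "z = \<sigma> (s 0) (sigma_omega \<sigma> (\<lambda>i. s (Suc i)))"
    using s sigma_omega_Suc emits_letters[OF x] by blast
  then have "z \<in> \<sigma> (s 0) ` denotation \<alpha> \<sigma> y"
    using y(2) by (auto simp: denotation_def)
  then show "z \<in> (\<Union>(a, y)\<in>\<alpha> x. \<sigma> a ` denotation \<alpha> \<sigma> y)"
    using y(1) by blast
next
  fix z
  assume "z \<in> (\<Union>(a, y)\<in>\<alpha> x. \<sigma> a ` denotation \<alpha> \<sigma> y)"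
  then obtain a y s where e: "(a, y) \<in> \<alpha> x" "emits \<alpha> y s" "z = \<sigma> a (sigma_omega \<sigma> s)"
    by (auto simp: denotation_def)
  have em: "emits \<alpha> x (case_nat a s)" using emits_Cons e by metis
  then have "sigma_omega \<sigma> (case_nat a s) = z"
    using sigma_omega_Suc[of "case_nat a s"] emits_letters[OF x] e(3) by simp
  then show "z \<in> denotation \<alpha> \<sigma> x" using em by (auto simp: denotation_def)
qed

lemma denotation_nonempty:
  assumes x: "x \<in> X"
  shows "denotation \<alpha> \<sigma> x \<noteq> {}"
proof -
  \<comment> \<open>Productivity allows every finite path to be prolonged. The clause for
    \<open>n = 0\<close> pins the start, which dependent choice would otherwise leave open.\<close>
  have "\<exists>q. \<forall>n. (q n \<in> X \<and> (n = 0 \<longrightarrow> q n = x)) \<and> (\<exists>a. (a, q (Suc n)) \<in> \<alpha> (q n))"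
  proof (rule dependent_nat_choice)
    fix y and n :: nat
    assume "y \<in> X \<and> (n = 0 \<longrightarrow> y = x)"
    then show "\<exists>y'. (y' \<in> X \<and> (Suc n = 0 \<longrightarrow> y' = x)) \<and> (\<exists>a. (a, y') \<in> \<alpha> y)"
      using productive edge by (metis ex_in_conv nat.distinct(1) surj_pair)
  qed (use x in auto)
  then obtain q where q: "q 0 = x" "\<And>n. \<exists>a. (a, q (Suc n)) \<in> \<alpha> (q n)" by blast
  from q(2) obtain s where "\<And>n. (s n, q (Suc n)) \<in> \<alpha> (q n)" by metis
  then have "emits \<alpha> x s" using emits_infinite_path q(1) by metis
  then show ?thesis by (auto simp: denotation_def)
qed

section \<open>Total boundedness and the closures of denotations\<close>

text \<open>Each use of the solution equation multiplies the radius of a cover by \<open>r\<close>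
  and keeps the set of centres finite, because a state has finitely many edges. The constant
  \<open>C\<close> is common to all states and depths.\<close>

lemma denotation_covered:
  obtains C where
    "\<And>x n. x \<in> X \<Longrightarrow> \<exists>K. finite K \<and> denotation \<alpha> \<sigma> x \<subseteq> (\<Union>k\<in>K. cball k (r ^ n * C))"
proof -
  fix p0 :: 'm
  obtain C where C: "0 \<le> C" "\<And>a p. a \<in> A \<Longrightarrow> p \<in> cball p0 C \<Longrightarrow> \<sigma> a p \<in> cball p0 C"
    using invariant_ball[of p0] by blast
  \<comment> \<open>Depth 0: all prefix images of \<open>p0\<close> stay in the closed invariant
    ball, hence so do the stream limits, and the single centre \<open>p0\<close> suffices.\<close>
  have base: "denotation \<alpha> \<sigma> x \<subseteq> cball p0 C" if x: "x \<in> X" for x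
  proof
    fix z
    assume "z \<in> denotation \<alpha> \<sigma> x"
    then obtain s where s: "emits \<alpha> x s" "z = sigma_omega \<sigma> s" by (auto simp: denotation_def)
    have sA: "range s \<subseteq> A" using emits_letters[OF x s(1)] .
    have "prefix_map \<sigma> s n p0 \<in> cball p0 C" for n
      using C by (intro prefix_map_in_ball[OF sA]) auto
    then show "z \<in> cball p0 C"
      unfolding s(2) using sigma_omega_limit[OF sA]
      by (rule closed_sequentially[OF closed_cball])
  qed
  have "\<exists>K. finite K \<and> denotation \<alpha> \<sigma> x \<subseteq> (\<Union>k\<in>K. cball k (r ^ n * C))" if "x \<in> X" for x n
    using that
  proof (induction n arbitrary: x)
    case 0
    then show ?case using base by (intro exI[of _ "{p0}"]) simp
  next
    case (Suc n)
    then obtain K where K: "\<And>y. y \<in> X \<Longrightarrow> finite (K y)"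
      "\<And>y. y \<in> X \<Longrightarrow> denotation \<alpha> \<sigma> y \<subseteq> (\<Union>k\<in>K y. cball k (r ^ n * C))"
      by metis
    define L where "L = (\<Union>(a, y)\<in>\<alpha> x. \<sigma> a ` K y)"
    have "finite L"
      unfolding L_def using finite_edges[OF Suc.prems] K(1) edge[OF Suc.prems] by auto
    moreover have "denotation \<alpha> \<sigma> x \<subseteq> (\<Union>k\<in>L. cball k (r ^ Suc n * C))"
    proof
      fix z
      assume "z \<in> denotation \<alpha> \<sigma> x"
      then obtain a y z' where z: "(a, y) \<in> \<alpha> x" "z' \<in> denotation \<alpha> \<sigma> y" "z = \<sigma> a z'"
        using denotation_eq[OF Suc.prems] by auto
      have ay: "a \<in> A" "y \<in> X" using edge[OF Suc.prems z(1)] by auto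
      obtain k where k: "k \<in> K y" "dist k z' \<le> r ^ n * C"
        using K(2)[OF ay(2)] z(2) by auto
      have "dist (\<sigma> a k) z \<le> r * dist k z'" using contraction ay(1) z(3) by simp
      also have "\<dots> \<le> r * (r ^ n * C)" using k(2) r_nonneg by (rule mult_left_mono)
      finally have "z \<in> cball (\<sigma> a k) (r ^ Suc n * C)" by (simp add: mult_ac)
      moreover have "\<sigma> a k \<in> L" unfolding L_def using z(1) k(1) by blast
      ultimately show "z \<in> (\<Union>k\<in>L. cball k (r ^ Suc n * C))" by blast
    qed
    ultimately show ?case by blast
  qed
  then show ?thesis using that by blast
qed

lemma compact_closure_denotation:
  assumes x: "x \<in> X"
  shows "compact (closure (denotation \<alpha> \<sigma> x))"
  unfolding compact_eq_totally_bounded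
proof (intro conjI allI impI)
  show "complete (closure (denotation \<alpha> \<sigma> x))"
    by (simp add: complete_eq_closed)
  fix e :: real
  assume e: "e > 0"
  obtain C where C:
    "\<And>x n. x \<in> X \<Longrightarrow> \<exists>K. finite K \<and> denotation \<alpha> \<sigma> x \<subseteq> (\<Union>k\<in>K. cball k (r ^ n * C))"
    using denotation_covered by blast
  have "\<forall>\<^sub>F n in sequentially. r ^ n * C < e"
    using e by (rule order_tendstoD(2)[OF power_r_tendsto])
  then obtain n where n: "r ^ n * C < e"
    unfolding eventually_sequentially by blast
  obtain K where K: "finite K" "denotation \<alpha> \<sigma> x \<subseteq> (\<Union>k\<in>K. cball k (r ^ n * C))"
    using C[OF x] by blast
  \<comment> \<open>A finite union of closed balls is closed, so the cover of the denotation also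
    covers its closure.\<close>
  have "closure (denotation \<alpha> \<sigma> x) \<subseteq> (\<Union>k\<in>K. cball k (r ^ n * C))"
    using K by (intro closure_minimal closed_UN) auto
  also have "\<dots> \<subseteq> (\<Union>k\<in>K. ball k e)" using n by force
  finally show "\<exists>K. finite K \<and> closure (denotation \<alpha> \<sigma> x) \<subseteq> (\<Union>k\<in>K. ball k e)"
    using K(1) by blast
qed

text \<open>A continuous image of a closed set may fail to be closed; here the closure is compact,
  so its image is compact and therefore closed.\<close>

lemma closure_image_denotation:
  assumes "y \<in> X" "a \<in> A"
  shows "closure (\<sigma> a ` denotation \<alpha> \<sigma> y) = \<sigma> a ` closure (denotation \<alpha> \<sigma> y)"
proof
  have "compact (\<sigma> a ` closure (denotation \<alpha> \<sigma> y))"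
    using assms by (intro compact_continuous_image continuous_contraction compact_closure_denotation)
  then show "closure (\<sigma> a ` denotation \<alpha> \<sigma> y) \<subseteq> \<sigma> a ` closure (denotation \<alpha> \<sigma> y)"
    by (intro closure_minimal image_mono closure_subset compact_imp_closed)
  show "\<sigma> a ` closure (denotation \<alpha> \<sigma> y) \<subseteq> closure (\<sigma> a ` denotation \<alpha> \<sigma> y)"
    using assms by (intro image_closure_subset continuous_contraction closed_closure closure_subset)
qed

text \<open>Closure commutes with the finite union over edges and with the letter maps, so the
  equation passes to closures. This yields a solution before the denotations are known to be
  compact.\<close>

lemma sigma_solution_closure:
  "sigma_solution X \<alpha> \<sigma> (\<lambda>x. closure (denotation \<alpha> \<sigma> x))"
  unfolding sigma_solution_def
proof (intro conjI ballI)
  show "(\<lambda>x. closure (denotation \<alpha> \<sigma> x)) \<in> X \<rightarrow> nonempty_compacts"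
    using compact_closure_denotation denotation_nonempty by (auto simp: nonempty_compacts_def)
  fix x
  assume x: "x \<in> X"
  have "closure (denotation \<alpha> \<sigma> x) = (\<Union>e\<in>\<alpha> x. closure (\<sigma> (fst e) ` denotation \<alpha> \<sigma> (snd e)))"
    unfolding denotation_eq[OF x] case_prod_beta
    by (rule closure_UN_finite[OF finite_edges[OF x]])
  also have "\<dots> = (\<Union>(a, y)\<in>\<alpha> x. \<sigma> a ` closure (denotation \<alpha> \<sigma> y))"
    using edge[OF x] by (intro SUP_cong) (auto simp: closure_image_denotation)
  finally show "closure (denotation \<alpha> \<sigma> x) = (\<Union>(a, y)\<in>\<alpha> x. \<sigma> a ` closure (denotation \<alpha> \<sigma> y))" .
qed

section \<open>Uniqueness of solutions and compactness of denotations\<close>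

lemma sigma_solution_path_image:
  assumes sol: "sigma_solution X \<alpha> \<sigma> \<phi>"
    and q: "q 0 \<in> X" "\<forall>i<n. (s i, q (Suc i)) \<in> \<alpha> (q i)"
    and z: "z \<in> \<phi> (q n)"
  shows "prefix_map \<sigma> s n z \<in> \<phi> (q 0)"
  using q(2) z
proof (induction n arbitrary: z)
  case (Suc n)
  have "q n \<in> X" using path_in_X[of q "Suc n" s n] q(1) Suc.prems(1) by simp
  then have "\<sigma> (s n) z \<in> \<phi> (q n)"
    using sol Suc.prems unfolding sigma_solution_def by blast
  then show ?case using Suc by simp
qed simp

lemma sigma_solution_unique:
  assumes sol: "sigma_solution X \<alpha> \<sigma> \<phi>" and x: "x \<in> X"
  shows "\<phi> x = denotation \<alpha> \<sigma> x"
proof -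
  have ne: "\<phi> y \<noteq> {}" and comp: "compact (\<phi> y)" if "y \<in> X" for y
    using sol that unfolding sigma_solution_def nonempty_compacts_def by blast+
  have unfold: "\<phi> y = (\<Union>(a, y')\<in>\<alpha> y. \<sigma> a ` \<phi> y')" if "y \<in> X" for y
    using sol that unfolding sigma_solution_def by blast
  fix p0 :: 'm
  \<comment> \<open>Finitely many compact values give one bound \<open>C\<close> for the points of
    all \<open>\<phi> y\<close>, as \<open>prefix_map_same_limit\<close> requires when the base
    points wander between states.\<close>
  have "bounded (\<Union>y\<in>X. \<phi> y)"
    using finite_X comp compact_imp_bounded by (intro bounded_UN) auto
  then obtain C where C: "\<And>y z. y \<in> X \<Longrightarrow> z \<in> \<phi> y \<Longrightarrow> dist z p0 \<le> C"
    unfolding bounded_any_center[of _ p0] by (auto simp: dist_commute)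
  show ?thesis
  proof (intro equalityI subsetI)
    fix z
    assume z: "z \<in> \<phi> x"
    \<comment> \<open>States are paired with points of their value: the equation writes each point
      as a letter applied to a point at a successor. Repeating this forever yields an infinite path
      together with its stream.\<close>
    let ?P = "\<lambda>n w. fst w \<in> X \<and> snd w \<in> \<phi> (fst w) \<and> (n = 0 \<longrightarrow> w = (x, z))"
    let ?Q = "\<lambda>w w'. \<exists>a. (a, fst w') \<in> \<alpha> (fst w) \<and> snd w = \<sigma> a (snd w')"
    have "\<exists>w. \<forall>n::nat. ?P n (w n) \<and> ?Q (w n) (w (Suc n))"
    proof (rule dependent_nat_choice)
      show "\<exists>w. ?P 0 w" using x z by auto
    next
      fix w and n :: nat
      assume w: "?P n w"
      then obtain a y' z' where e: "(a, y') \<in> \<alpha> (fst w)" "z' \<in> \<phi> y'" "snd w = \<sigma> a z'"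
        using unfold[of "fst w"] by auto
      then have "y' \<in> X" using edge w by blast
      then show "\<exists>w'. ?P (Suc n) w' \<and> ?Q w w'"
        using e by (intro exI[of _ "(y', z')"]) auto
    qed
    then obtain w where w0: "w 0 = (x, z)"
      and wX: "\<And>n. fst (w n) \<in> X" "\<And>n. snd (w n) \<in> \<phi> (fst (w n))"
      and step: "\<And>n. ?Q (w n) (w (Suc n))" by blast
    from step obtain s where s: "\<And>n. (s n, fst (w (Suc n))) \<in> \<alpha> (fst (w n))"
      "\<And>n. snd (w n) = \<sigma> (s n) (snd (w (Suc n)))" by metis
    have em: "emits \<alpha> x s"
      using emits_infinite_path[of "\<lambda>n. fst (w n)" x s \<alpha>] w0 s(1) by simp
    have sA: "range s \<subseteq> A" using emits_letters[OF x em] .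
    \<comment> \<open>The prefix map undoes the \<open>n\<close> unfoldings, so the sequence is
      constantly \<open>z\<close> and yet converges to the stream limit.\<close>
    have "prefix_map \<sigma> s n (snd (w n)) = z" for n
      by (induction n) (simp_all add: w0 flip: s(2))
    moreover have "(\<lambda>n. prefix_map \<sigma> s n (snd (w n))) \<longlonglongrightarrow> sigma_omega \<sigma> s"
      by (rule prefix_map_same_limit[OF sA sigma_omega_limit[OF sA]]) (rule C[OF wX])
    ultimately have "z = sigma_omega \<sigma> s" by (simp add: LIMSEQ_const_iff)
    then show "z \<in> denotation \<alpha> \<sigma> x" using em by (auto simp: denotation_def)
  next
    fix z
    assume "z \<in> denotation \<alpha> \<sigma> x"
    then obtain s where s: "emits \<alpha> x s" "z = sigma_omega \<sigma> s" by (auto simp: denotation_def)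
    have sA: "range s \<subseteq> A" using emits_letters[OF x s(1)] .
    \<comment> \<open>The path may differ for each \<open>n\<close>, so its endpoint and the chosen
      \<open>w\<close> may too; the common bound \<open>C\<close> makes this harmless. Length
      \<open>Suc n\<close> covers the case \<open>n = 0\<close>.\<close>
    have "\<exists>w y. y \<in> X \<and> w \<in> \<phi> y \<and> prefix_map \<sigma> s n w \<in> \<phi> x" for n
    proof -
      obtain q where q: "q 0 = x" "\<forall>i<Suc n. (s i, q (Suc i)) \<in> \<alpha> (q i)"
        using s(1) unfolding emits_def by blast
      then have q': "\<forall>i<n. (s i, q (Suc i)) \<in> \<alpha> (q i)" by simp
      have qn: "q n \<in> X" using path_in_X[of q n s n] q' q(1) x by simp
      then obtain w where "w \<in> \<phi> (q n)" using ne by blast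
      then show ?thesis using sigma_solution_path_image[OF sol _ q'] q(1) x qn by blast
    qed
    then obtain w where w: "\<And>n. dist (w n) p0 \<le> C" "\<And>n. prefix_map \<sigma> s n (w n) \<in> \<phi> x"
      using C by metis
    have "(\<lambda>n. prefix_map \<sigma> s n (w n)) \<longlonglongrightarrow> z"
      using prefix_map_same_limit[OF sA sigma_omega_limit[OF sA] w(1)] s(2) by simp
    with w(2) show "z \<in> \<phi> x"
      by (rule closed_sequentially[OF compact_imp_closed[OF comp[OF x]]])
  qed
qed

text \<open>There is no circularity: uniqueness assumes compact values of the solution, not of the
  denotation. Applied to the closures, it identifies them with the denotations.\<close>

lemma compact_denotation:
  assumes "x \<in> X"
  shows "compact (denotation \<alpha> \<sigma> x)"
  using compact_closure_denotation[OF assms] sigma_solution_unique[OF sigma_solution_closure assms]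
  by simp

lemma sigma_solution_denotation: "sigma_solution X \<alpha> \<sigma> (denotation \<alpha> \<sigma>)"
  unfolding sigma_solution_def nonempty_compacts_def
  using denotation_nonempty compact_denotation denotation_eq by blast

end

section \<open>A common contraction factor and the conclusion\<close>

lemma uniform_contraction_factor:
  fixes \<sigma> :: "'a \<Rightarrow> 'm \<Rightarrow> 'm::metric_space"
  assumes "finite A" "\<sigma> \<in> A \<rightarrow> contractions"
  obtains r :: real where "0 \<le> r" "r < 1"
    "\<And>a p q. a \<in> A \<Longrightarrow> dist (\<sigma> a p) (\<sigma> a q) \<le> r * dist p q"
proof -
  have "\<forall>a\<in>A. \<exists>\<rho>\<in>{0..<1}. \<forall>p q. dist (\<sigma> a p) (\<sigma> a q) \<le> \<rho> * dist p q"
    using assms(2) by (auto simp: contractions_def Pi_iff)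
  then obtain \<rho> where \<rho>: "\<And>a. a \<in> A \<Longrightarrow> \<rho> a \<in> {0..<1::real}"
    "\<And>a p q. a \<in> A \<Longrightarrow> dist (\<sigma> a p) (\<sigma> a q) \<le> \<rho> a * dist p q" by metis
  \<comment> \<open>Finiteness of \<open>A\<close> keeps the largest factor below 1; the inserted 0
    covers an empty \<open>A\<close>.\<close>
  define r where "r = Max (insert 0 (\<rho> ` A))"
  have le: "\<rho> a \<le> r" if "a \<in> A" for a using that assms(1) by (simp add: r_def)
  have "dist (\<sigma> a p) (\<sigma> a q) \<le> r * dist p q" if "a \<in> A" for a p q
    using order_trans[OF \<rho>(2)[OF that] mult_right_mono[OF le[OF that]]] by simp
  moreover have "0 \<le> r" "r < 1" using assms(1) \<rho>(1) by (auto simp: r_def)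
  ultimately show ?thesis using that by blast
qed

theorem mainTheorem2:
  fixes A :: "'a set"
    and X :: "'x set"
    and \<alpha> :: "'x \<Rightarrow> ('a \<times> 'x) set"
    and \<sigma> :: "'a \<Rightarrow> 'm \<Rightarrow> 'm::complete_space"
  assumes "finite A"
    and "\<sigma> \<in> A \<rightarrow> contractions"
    and "lts A X \<alpha>"
    and "finite X"
    and "productive X \<alpha>"
  shows "(\<forall>x\<in>X. denotation \<alpha> \<sigma> x \<noteq> {} \<and> compact (denotation \<alpha> \<sigma> x)) \<and>
         sigma_solution X \<alpha> \<sigma> (denotation \<alpha> \<sigma>) \<and>
         (\<forall>\<phi>. sigma_solution X \<alpha> \<sigma> \<phi> \<longrightarrow> (\<forall>x\<in>X. \<phi> x = denotation \<alpha> \<sigma> x))"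
proof -
  obtain r where r: "0 \<le> r" "r < 1"
    "\<And>a p q. a \<in> A \<Longrightarrow> dist (\<sigma> a p) (\<sigma> a q) \<le> r * dist p q"
    using uniform_contraction_factor[OF assms(1,2)] by blast
  have edge: "a \<in> A \<and> y \<in> X" if "x \<in> X" "(a, y) \<in> \<alpha> x" for x a y
    using assms(3) that unfolding lts_def by blast
  interpret contractive_lts A X \<alpha> \<sigma> r
    by unfold_locales (use assms(1,4,5) edge r in \<open>auto simp: productive_def\<close>)
  show ?thesis
    using denotation_nonempty compact_denotation sigma_solution_denotation sigma_solution_unique
    by blast
qed

end
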